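(* Let $n\ge1$ be a fixed degree and $\omega\in(0,(n+1)\pi)$. The best approximation $r$ to $\mathrm{e}^{\mathrm{i}\omega x}$ in $\mathcal{U}_n$ is symmetric, i.e., $r(-z)=r(z)^{-1}$ for $z\in\mathbb{C}$ (as an identity of rational functions).
   Context: For a complex polynomial $p$ let $p^\dag(z):=\overline{p}(-z)=\overline{p(-\overline z)}$, where $\overline p$ has complex-conjugated coefficients. Let $\mathcal{U}_n:=\{p^\dag/p : p \text{ a complex polynomial of degree}\le n,\ p\not\equiv 0\}$, with rational functions identified with their irreducible form; then $|r(\mathrm{i}x)|=1$ for $r\in\mathcal{U}_n$, $x\in\mathbb{R}$. For $r\in\mathcal{U}_n$, $\|r-\exp(\omega\cdot)\|:=\max_{x\in[-1,1]}|r(\mathrm{i}x)-\mathrm{e}^{\mathrm{i}\omega x}|$. For $\omega\in(0,(n+1)\pi)$ the best approximation to $\mathrm{e}^{\mathrm{i}\omega x}$ in $\mathcal{U}_n$ is the (existing and unique) $r\in\mathcal{U}_n$ with $\|r-\exp(\omega\cdot)\|=\min_{u\in\mathcal{U}_n}\|u-\exp(\omega\cdot)\|$. *)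

theory Defs
  imports "HOL-Analysis.Analysis" "HOL-Computational_Algebra.Computational_Algebra"
    "HOL-Computational_Algebra.Field_as_Ring"
begin

text \<open>
  Rational functions are elements of the field of fractions of the polynomial ring,
  and \<^const>\<open>quot_of_fract\<close> gives numerator and denominator of the irreducible form.
\<close>
type_synonym ratfun = "complex poly fract"

definition dag :: "complex poly \<Rightarrow> complex poly" where
  "dag p = map_poly cnj p \<circ>\<^sub>p [:0, -1:]"

lemma poly_dag: "poly (dag p) z = cnj (poly p (- cnj z))"
  by (simp add: dag_def poly_pcompose)

definition unitary_ratfuns :: "nat \<Rightarrow> ratfun set" where
  "unitary_ratfuns n = {Fraction_Field.Fract (dag p) p | p. p \<noteq> 0 \<and> degree p \<le> n}"

text \<open>
  Evaluation uses the irreducible form, so that removable singularities are removed.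
  At a genuine pole the value is 0 by the convention for division by zero.
\<close>
definition ratfun_eval :: "ratfun \<Rightarrow> complex \<Rightarrow> complex" where
  "ratfun_eval r z = poly (fst (quot_of_fract r)) z / poly (snd (quot_of_fract r)) z"

text \<open>The rational function \<open>z \<mapsto> r(-z)\<close>; see \<open>ratfun_reflect_Fract\<close> below.\<close>
definition ratfun_reflect :: "ratfun \<Rightarrow> ratfun" where
  "ratfun_reflect r = Fraction_Field.Fract (fst (quot_of_fract r) \<circ>\<^sub>p [:0, -1:])
                                           (snd (quot_of_fract r) \<circ>\<^sub>p [:0, -1:])"

text \<open>
  For members of \<^const>\<open>unitary_ratfuns\<close> the supremum is a maximum; see
  \<open>approx_error_attained\<close> below.
\<close>
definition approx_error :: "real \<Rightarrow> ratfun \<Rightarrow> real" where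
  "approx_error \<omega> r =
     (SUP x\<in>{-1..1::real}. cmod (ratfun_eval r (\<i> * of_real x) - exp (\<i> * of_real (\<omega> * x))))"

definition is_best_approx :: "nat \<Rightarrow> real \<Rightarrow> ratfun \<Rightarrow> bool" where
  "is_best_approx n \<omega> r \<longleftrightarrow>
     r \<in> unitary_ratfuns n \<and> (\<forall>u\<in>unitary_ratfuns n. approx_error \<omega> r \<le> approx_error \<omega> u)"

lemma Fract_quot_of_fract:
  "Fraction_Field.Fract (fst (quot_of_fract r)) (snd (quot_of_fract r)) = (r :: ratfun)"
  using quot_to_fract_quot_of_fract[of r] by (simp add: quot_to_fract_def case_prod_unfold)

lemma snd_quot_of_fract_neq_0: "snd (quot_of_fract (r :: ratfun)) \<noteq> 0"
  by transfer simp

lemma pcompose_uminus_eq_0_iff: "p \<circ>\<^sub>p [:0, -1:] = 0 \<longleftrightarrow> p = (0 :: complex poly)"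
  by (rule pcompose_eq_0_iff) simp

lemma ratfun_reflect_Fract:
  assumes "q \<noteq> 0"
  shows "ratfun_reflect (Fraction_Field.Fract p q) =
         Fraction_Field.Fract (p \<circ>\<^sub>p [:0, -1:]) (q \<circ>\<^sub>p [:0, -1:])"
proof -
  let ?r = "Fraction_Field.Fract p q"
  let ?a = "fst (quot_of_fract ?r)" and ?b = "snd (quot_of_fract ?r)"
  have "Fraction_Field.Fract ?a ?b = ?r" by (rule Fract_quot_of_fract)
  then have "?a * q = p * ?b"
    by (simp only: eq_fract(1)[OF snd_quot_of_fract_neq_0 assms])
  then have "(?a \<circ>\<^sub>p [:0, -1:]) * (q \<circ>\<^sub>p [:0, -1:]) = (p \<circ>\<^sub>p [:0, -1:]) * (?b \<circ>\<^sub>p [:0, -1:])"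
    by (metis pcompose_mult)
  then show ?thesis
    using assms snd_quot_of_fract_neq_0[of ?r]
    by (simp add: ratfun_reflect_def eq_fract pcompose_uminus_eq_0_iff)
qed

lemma dag_mult: "dag (p * q) = dag p * dag q"
  by (rule poly_ext) (simp add: poly_dag)

lemma dag_dag: "dag (dag p) = p"
  by (rule poly_ext) (simp add: poly_dag)

lemma dag_eq_0_iff: "dag p = 0 \<longleftrightarrow> p = 0"
proof
  assume "dag p = 0"
  then have "p = dag 0" by (metis dag_dag)
  then show "p = 0" by (simp add: dag_def)
qed (simp add: dag_def)

lemma unitary_ratfuns_imag_axis:
  assumes "r \<in> unitary_ratfuns n"
  shows "poly (snd (quot_of_fract r)) (\<i> * of_real x) \<noteq> 0"
    and "cmod (ratfun_eval r (\<i> * of_real x)) = 1"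
proof -
  let ?a = "fst (quot_of_fract r)" and ?b = "snd (quot_of_fract r)"
  let ?z = "\<i> * of_real x"
  obtain p where p: "p \<noteq> 0" "r = Fraction_Field.Fract (dag p) p"
    using assms by (auto simp: unitary_ratfuns_def)
  have "Fraction_Field.Fract ?a ?b = Fraction_Field.Fract (dag p) p"
    using Fract_quot_of_fract[of r] p by simp
  then have 1: "?a * p = dag p * ?b"
    by (simp only: eq_fract(1)[OF snd_quot_of_fract_neq_0 p(1)])
  then have 2: "dag ?a * dag p = p * dag ?b"
    by (metis dag_mult dag_dag)
  have "(p * dag p) * (?a * dag ?a) = (?a * p) * (dag ?a * dag p)" by (simp add: ac_simps)
  also have "\<dots> = (p * dag p) * (?b * dag ?b)" unfolding 1 2 by (simp add: ac_simps)
  finally have "?a * dag ?a = ?b * dag ?b"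
    using p by (simp add: dag_eq_0_iff)
  then have "poly (?a * dag ?a) ?z = poly (?b * dag ?b) ?z" by simp
  then have "poly ?a ?z * cnj (poly ?a ?z) = poly ?b ?z * cnj (poly ?b ?z)"
    by (simp add: poly_dag)
  then have "complex_of_real ((cmod (poly ?a ?z))\<^sup>2) = complex_of_real ((cmod (poly ?b ?z))\<^sup>2)"
    by (simp only: complex_norm_square)
  then have eq: "cmod (poly ?a ?z) = cmod (poly ?b ?z)"
    by (simp only: of_real_eq_iff) simp
  have "coprime ?a ?b"
    using quot_of_fract_in_normalized_fracts[of r]
    by (auto simp: normalized_fracts_def case_prod_unfold)
  then have "poly ?a ?z \<noteq> 0 \<or> poly ?b ?z \<noteq> 0"
    using coprime_common_divisor[of ?a ?b "[:- ?z, 1:]"]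
    by (auto simp: poly_eq_0_iff_dvd is_unit_iff_degree)
  with eq show nz: "poly ?b ?z \<noteq> 0" by auto
  with eq show "cmod (ratfun_eval r ?z) = 1"
    by (simp add: ratfun_eval_def norm_divide)
qed

lemma approx_error_attained:
  fixes \<omega> :: real
  assumes "r \<in> unitary_ratfuns n"
  defines "f \<equiv> \<lambda>x. cmod (ratfun_eval r (\<i> * of_real x) - exp (\<i> * of_real (\<omega> * x)))"
  shows "\<exists>x\<in>{-1..1}. approx_error \<omega> r = f x \<and> (\<forall>y\<in>{-1..1}. f y \<le> f x)"
proof -
  have "continuous_on {-1..1} f"
    unfolding f_def ratfun_eval_def
    by (intro continuous_intros) (use unitary_ratfuns_imag_axis(1)[OF assms(1)] in auto)
  then obtain x where x: "x \<in> {-1..1}" "\<forall>y\<in>{-1..1}. f y \<le> f x"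
    using continuous_attains_sup[of "{-1..1}" f] by auto
  then have "(SUP y\<in>{-1..1}. f y) = f x"
    by (intro cSup_eq_maximum) auto
  with x show ?thesis
    unfolding approx_error_def f_def by blast
qed

end

theory Submission
  imports Defs
begin

text \<open>
  If \<open>r\<close> is a best approximation, then so is \<open>z \<mapsto> 1 / r(-z)\<close>: on the imaginary axis this function
  is \<open>cnj (r(-ix))\<close>, and \<open>exp (i\<omega>x)\<close> is likewise the conjugate of its value at \<open>-x\<close>
  (\<open>reflected_inverse_unitary\<close>). Symmetry of \<open>r\<close> is therefore a consequence of uniqueness,
  \<open>best_approx_unique\<close>, which is the real content.

  The proof of uniqueness linearises the problem. For \<open>r = dag p / p\<close> put
  \<open>q(x) = p(ix) exp(i\<omega>x/2)\<close>. The error at \<open>x\<close> is \<open>2 \<bar>Im q(x)\<bar> / \<bar>q(x)\<bar>\<close>, so an error of at most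
  \<open>2s\<close> with \<open>s < 1\<close> says that \<open>q\<close> stays in the double sector \<open>\<bar>Im q\<bar> \<le> s \<bar>q\<bar>\<close>, hence, after a choice of the
  sign of \<open>p\<close>, in one convex cone around the positive real axis. Sums of such polynomials have the same
  property.

  First, the minimal error is below \<open>2\<close>. For this it suffices that \<open>Re q > 0\<close> on \<open>[-1,1]\<close> for some
  \<open>p\<close> of degree at most \<open>n\<close>; in the variable \<open>t = \<omega>x/2 + (n+1)\<pi>/2\<close>, which stays in
  \<open>(0,(n+1)\<pi>)\<close> exactly because \<open>\<omega> < (n+1)\<pi>\<close>, one takes for \<open>Re q\<close> the nonnegative function
  \<open>(\<Prod>j=1..n. j\<pi> - t) sin t\<close> plus a small multiple of \<open>Q(t) cos t\<close> with \<open>Q\<close> positive or negative at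
  the zeros as needed (\<open>rotated_Re_positive_exists\<close>).

  Now let \<open>p1\<close> and \<open>p2\<close> give two best approximations, both normalised into the cone, and let
  \<open>p = p1 + p2 = g p'\<close> where \<open>g\<close> is real on the axis and \<open>p'\<close> is coprime to \<open>dag p'\<close>. Let \<open>X\<close> be
  the set of points where \<open>q\<close> lies on the boundary of the cone. If \<open>X\<close> had at most \<open>n + deg p'\<close> points,
  then a direction \<open>u\<close> with prescribed values of \<open>Im (u cnj p')\<close> on \<open>X\<close> would move \<open>q\<close> into
  the interior and decrease the error (\<open>descent_of_few_extremal_points\<close>); such a \<open>u\<close> of degree
  at most \<open>n\<close> comes from Bezout's identity for \<open>p'\<close> and \<open>dag p'\<close>. So \<open>X\<close> is larger. But where the
  sum of two cone elements is on a boundary ray, so are both summands, and \<open>p1\<close> and \<open>p'\<close> have the same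
  argument modulo \<open>\<pi>\<close> there. The polynomial \<open>p1 dag p' - dag p1 p'\<close>, of degree at most \<open>n + deg p'\<close>, has too
  many zeros and vanishes, which gives \<open>dag p1 / p1 = dag p2 / p2\<close>.
\<close>

section \<open>Perturbation on compact sets and interpolation\<close>

text \<open>
  Both strict inequalities below are obtained by perturbing a weak one to first order. If no \<open>\<epsilon>\<close>
  worked, points violating the claim for \<open>\<epsilon> \<rightarrow> 0\<close> would accumulate at some \<open>x\<close> with
  \<open>a x = 0\<close> and \<open>b x \<ge> 0\<close>.
\<close>
lemma negative_perturbation_on_compact:
  fixes a b c :: "real \<Rightarrow> real"
  assumes K: "compact K" and ca: "continuous_on K a" and cb: "continuous_on K b" and cc: "continuous_on K c"
    and le: "\<And>x. x \<in> K \<Longrightarrow> a x \<le> 0"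
    and neg: "\<And>x. x \<in> K \<Longrightarrow> a x = 0 \<Longrightarrow> b x < 0"
  shows "\<exists>\<epsilon>>0. \<forall>x\<in>K. a x + \<epsilon> * b x + \<epsilon>\<^sup>2 * c x < 0"
proof (rule ccontr)
  define e where "e k = inverse (real (Suc k))" for k
  have e_pos: "e k > 0" for k by (simp add: e_def)
  assume "\<not> ?thesis"
  then have "\<exists>x\<in>K. a x + e k * b x + (e k)\<^sup>2 * c x \<ge> 0" for k
    using e_pos[of k] by (meson not_le)
  then obtain X where X: "\<And>k. X k \<in> K" "\<And>k. a (X k) + e k * b (X k) + (e k)\<^sup>2 * c (X k) \<ge> 0"
    by metis
  obtain x \<sigma> where x: "x \<in> K" and \<sigma>: "strict_mono \<sigma>" and lim: "(X \<circ> \<sigma>) \<longlonglongrightarrow> x"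
    using K X(1) unfolding compact_def by metis
  have e0: "(\<lambda>k. e (\<sigma> k)) \<longlonglongrightarrow> 0"
    using LIMSEQ_subseq_LIMSEQ[OF LIMSEQ_inverse_real_of_nat \<sigma>] by (simp add: e_def o_def)
  have along: "(\<lambda>k. f (X (\<sigma> k))) \<longlonglongrightarrow> f x" if "continuous_on K f" for f :: "real \<Rightarrow> real"
    using continuous_on_tendsto_compose[OF that lim x] X(1) by (simp add: o_def)
  have "(\<lambda>k. a (X (\<sigma> k)) + e (\<sigma> k) * b (X (\<sigma> k)) + (e (\<sigma> k))\<^sup>2 * c (X (\<sigma> k)))
          \<longlonglongrightarrow> a x + 0 * b x + 0\<^sup>2 * c x"
    by (intro tendsto_intros along ca cb cc e0)
  then have "a x \<ge> 0"
    using X(2) by (intro LIMSEQ_le_const) auto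
  with le[OF x] have ax: "a x = 0" by simp
  have "b (X (\<sigma> k)) + e (\<sigma> k) * c (X (\<sigma> k)) \<ge> 0" for k
  proof -
    have "0 \<le> e (\<sigma> k) * (b (X (\<sigma> k)) + e (\<sigma> k) * c (X (\<sigma> k)))"
      using X(2)[of "\<sigma> k"] le[OF X(1)[of "\<sigma> k"]] by (simp add: algebra_simps power2_eq_square)
    then show ?thesis using e_pos[of "\<sigma> k"] by (simp add: zero_le_mult_iff)
  qed
  moreover have "(\<lambda>k. b (X (\<sigma> k)) + e (\<sigma> k) * c (X (\<sigma> k))) \<longlonglongrightarrow> b x + 0 * c x"
    by (intro tendsto_intros along cb cc e0)
  ultimately have "b x \<ge> 0"
    by (intro LIMSEQ_le_const) auto
  with neg[OF x ax] show False by simp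
qed

text \<open>The bound \<open>card S\<close> (not \<open>card S - 1\<close>) avoids a special case for the empty set.\<close>
lemma poly_interpolation_exists:
  fixes f :: "'a::field \<Rightarrow> 'a"
  assumes "finite S"
  shows "\<exists>p. degree p \<le> card S \<and> (\<forall>x\<in>S. poly p x = f x)"
  using assms
proof (induction S)
  case empty
  show ?case by (rule exI[of _ 0]) simp
next
  case (insert a S)
  then obtain p where p: "degree p \<le> card S" "\<forall>x\<in>S. poly p x = f x" by blast
  define w where "w = (\<Prod>x\<in>S. [:- x, 1:])"
  have dw: "degree w = card S"
    unfolding w_def by (subst degree_prod_eq_sum_degree) auto
  have w: "poly w x = (\<Prod>y\<in>S. x - y)" for x
    by (simp add: w_def poly_prod)
  have wS: "poly w x = 0" if "x \<in> S" for x
    using that insert.hyps by (auto simp: w)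
  have wa: "poly w a \<noteq> 0"
    using insert.hyps by (auto simp: w)
  let ?q = "p + smult ((f a - poly p a) / poly w a) w"
  have "degree ?q \<le> card (insert a S)"
    using p(1) dw insert.hyps by (intro degree_add_le) (auto intro: order_trans[OF degree_smult_le])
  moreover have "\<forall>x\<in>insert a S. poly ?q x = f x"
    using p(2) wS wa by auto
  ultimately show ?case by blast
qed

section \<open>Polynomials and the involution dag\<close>

lemma dag_add: "dag (p + q) = dag p + dag q"
  by (rule poly_ext) (simp add: poly_dag)

lemma dag_diff: "dag (p - q) = dag p - dag q"
  by (rule poly_ext) (simp add: poly_dag)

lemma dag_minus: "dag (- p) = - dag p"
  by (rule poly_ext) (simp add: poly_dag)

lemma dag_smult: "dag (smult c p) = smult (cnj c) (dag p)"
  by (rule poly_ext) (simp add: poly_dag)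

lemma degree_dag: "degree (dag p) = degree p"
  by (simp add: dag_def degree_pcompose degree_map_poly)

lemma poly_dag_axis: "poly (dag p) (\<i> * of_real x) = cnj (poly p (\<i> * of_real x))"
  by (simp add: poly_dag)

text \<open>
  The roots of \<open>dag p\<close> are the reflections of those of \<open>p\<close> in the imaginary axis. Common roots
  therefore lie on the axis or come in reflected pairs, and in both cases the corresponding factor of
  \<open>p\<close> can be normalised to be invariant under \<^const>\<open>dag\<close>, that is, real on the axis.
\<close>
lemma dag_reduced_factorization:
  assumes "p \<noteq> 0"
  shows "\<exists>g p0. p = g * p0 \<and> dag g = g \<and> coprime p0 (dag p0)"
  using assms
proof (induction "degree p" arbitrary: p rule: less_induct)
  case less
  show ?case
  proof (cases "coprime p (dag p)")
    case True
    then show ?thesis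
      by (intro exI[of _ 1] exI[of _ p]) (auto intro!: poly_ext simp: poly_dag)
  next
    case False
    then obtain d where d: "d dvd p" "d dvd dag p" "\<not> is_unit d"
      by (rule not_coprimeE)
    have d0: "d \<noteq> 0" using d(1) less.prems by auto
    with d(3) have "degree d \<noteq> 0" by (simp add: is_unit_iff_degree)
    then have "\<not> constant (poly d)" by (simp add: constant_degree)
    then obtain w where w: "poly d w = 0" using fundamental_theorem_of_algebra by blast
    have pw: "poly p w = 0" and "poly (dag p) w = 0"
      using w d(1,2) by (auto elim!: dvdE)
    then have pw': "poly p (- cnj w) = 0" by (simp add: poly_dag)
    obtain h p1 where h: "p = h * p1" "dag h = h" "degree h > 0"
    proof (cases "w = - cnj w")
      case True
      obtain p1 where p1: "p = [:-w, 1:] * p1" using pw by (auto simp: poly_eq_0_iff_dvd elim: dvdE)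
      \<comment> \<open>the monic factor changes sign under dag; the factor \<open>-\<i>\<close> makes it invariant\<close>
      have "p = [: \<i> * w, - \<i>:] * smult \<i> p1"
        unfolding p1 by (rule poly_ext) (simp add: algebra_simps)
      moreover have "dag [: \<i> * w, - \<i>:] = [: \<i> * w, - \<i>:]"
        by (rule poly_ext) (subst (2) True, simp add: poly_dag algebra_simps)
      ultimately show ?thesis by (rule that) simp
    next
      case False
      obtain p1 where p1: "p = [:-w, 1:] * p1" using pw by (auto simp: poly_eq_0_iff_dvd elim: dvdE)
      have "(- cnj w - w) * poly p1 (- cnj w) = 0" using pw' by (simp add: p1 algebra_simps)
      moreover have "- cnj w - w \<noteq> 0" using False by (metis eq_iff_diff_eq_0)
      ultimately have "poly p1 (- cnj w) = 0" by simp
      then obtain p2 where p2: "p1 = [:cnj w, 1:] * p2" by (auto simp: poly_eq_0_iff_dvd elim: dvdE)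
      show ?thesis
      proof (rule that)
        show "p = ([:-w, 1:] * [:cnj w, 1:]) * p2" unfolding p1 p2 by (simp only: mult.assoc)
        show "dag ([:-w, 1:] * [:cnj w, 1:]) = [:-w, 1:] * [:cnj w, 1:]"
          by (rule poly_ext) (simp add: poly_dag algebra_simps)
      qed (simp add: degree_mult_eq)
    qed
    have nz: "h \<noteq> 0" "p1 \<noteq> 0" using less.prems h(1) by auto
    then have "degree p1 < degree p" using h by (simp add: degree_mult_eq)
    from less.hyps[OF this nz(2)] obtain g p0
      where g: "p1 = g * p0" "dag g = g" "coprime p0 (dag p0)" by blast
    show ?thesis
      using g h by (intro exI[of _ "h * g"] exI[of _ p0]) (simp add: dag_mult)
  qed
qed

text \<open>
  On the imaginary axis the equation reads \<open>Im (u cnj p) = f\<close>. Up to the factor \<open>-2 / \<bar>p\<bar>\<^sup>2\<close>, the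
  left-hand side is the derivative of the phase of \<open>dag p / p\<close> in the direction \<open>u\<close>, so every
  polynomial of degree at most \<open>n + degree p\<close> that is real on the axis occurs as such a derivative.
  Bezout's identity gives \<open>a dag p + b p = 2if\<close>; reducing \<open>a\<close> modulo \<open>p\<close> controls the degrees, and
  since the right-hand side is anti-invariant under \<^const>\<open>dag\<close>, averaging \<open>a\<close> with \<open>- dag b\<close>
  gives a solution in which the second coefficient is determined by the first.
\<close>
lemma coprime_dag_bezout:
  assumes cop: "coprime p (dag p)" and deg: "degree p \<le> n"
    and f: "dag f = f" "degree f \<le> n + degree p"
  shows "\<exists>u. degree u \<le> n \<and> u * dag p - dag u * p = smult (2 * \<i>) f"
proof -
  have p0: "p \<noteq> 0" using cop by (auto simp: dag_def)
  obtain a' b' where ab': "a' * dag p + b' * p = 1"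
    using cop bezout_coefficients_fst_snd[of "dag p" p] by (simp add: coprime_iff_gcd_eq_1 gcd.commute)
  define F where "F = smult (2 * \<i>) f"
  define a where "a = (F * a') mod p"
  define D where "D = (F * a') div p"
  define b where "b = F * b' + D * dag p"
  have D: "F * a' = D * p + a" by (simp add: a_def D_def)
  have "F = (F * a') * dag p + F * b' * p"
    using arg_cong[OF ab', of "\<lambda>h. F * h"] by (simp add: algebra_simps)
  also have "\<dots> = a * dag p + b * p"
    unfolding D b_def by (simp add: algebra_simps)
  finally have ab: "a * dag p + b * p = F" by simp
  have deg_a: "degree a \<le> degree p"
    unfolding a_def using degree_mod_less[OF p0, of "F * a'"] by auto
  have "degree (b * p) \<le> n + degree p"
  proof -
    have "b * p = F - a * dag p" using ab by (simp add: algebra_simps)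
    moreover have "degree F \<le> n + degree p" unfolding F_def using f(2) by simp
    moreover have "degree (a * dag p) \<le> n + degree p"
      using degree_mult_le[of a "dag p"] deg_a deg by (simp add: degree_dag)
    ultimately show ?thesis by (simp add: degree_diff_le)
  qed
  then have deg_b: "degree b \<le> n"
    using p0 by (cases "b = 0") (auto simp: degree_mult_eq)
  define u where "u = smult (1/2) (a - dag b)"
  have "dag F = - F" by (simp add: F_def dag_smult f(1))
  then have "dag a * p + dag b * dag p = - F"
    unfolding ab[symmetric] by (simp add: dag_add dag_mult dag_dag)
  then have "(a - dag b) * dag p - (dag a - b) * p = F + F"
    using ab by (simp add: algebra_simps)
  moreover have "u * dag p - dag u * p = smult (1/2) ((a - dag b) * dag p - (dag a - b) * p)"
    by (rule poly_ext) (simp add: u_def dag_smult dag_diff dag_dag field_simps)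
  ultimately have "u * dag p - dag u * p = smult (1/2) (F + F)" by simp
  also have "\<dots> = F" by (rule poly_ext) simp
  finally have "u * dag p - dag u * p = F" .
  moreover have "degree u \<le> n"
    unfolding u_def using deg_a deg_b deg by (simp add: degree_diff_le degree_dag)
  ultimately show ?thesis unfolding F_def by blast
qed

lemma coprime_dag_axis_nonzero:
  assumes "coprime p (dag p)"
  shows "poly p (\<i> * of_real x) \<noteq> 0"
proof
  let ?z = "\<i> * of_real x :: complex"
  assume "poly p ?z = 0"
  moreover from this have "poly (dag p) ?z = 0" by (simp add: poly_dag_axis)
  ultimately have "[:- ?z, 1:] dvd p" "[:- ?z, 1:] dvd dag p" by (simp_all add: poly_eq_0_iff_dvd)
  then have "is_unit [:- ?z, 1:]" using assms by (rule coprime_common_divisor[rotated])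
  then show False by (simp add: is_unit_iff_degree)
qed

lemma unitary_ratfuns_reduced:
  assumes "r \<in> unitary_ratfuns n"
  obtains p where "coprime p (dag p)" "p \<noteq> 0" "degree p \<le> n" "r = Fraction_Field.Fract (dag p) p"
proof -
  obtain p where p: "p \<noteq> 0" "degree p \<le> n" "r = Fraction_Field.Fract (dag p) p"
    using assms by (auto simp: unitary_ratfuns_def)
  obtain g q where g: "p = g * q" "dag g = g" "coprime q (dag q)"
    using dag_reduced_factorization[OF p(1)] by blast
  have nz: "g \<noteq> 0" "q \<noteq> 0" using p(1) g(1) by auto
  show ?thesis
  proof
    show "degree q \<le> n" using p(2) nz by (simp add: g(1) degree_mult_eq)
    show "r = Fraction_Field.Fract (dag q) q"
      using p(1) nz by (simp add: p(3) g(1,2) dag_mult eq_fract)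
  qed (use g nz in auto)
qed

section \<open>The error as a deviation from the real line\<close>

text \<open>
  The error of \<open>dag p / p\<close> at \<open>x\<close> depends only on the argument of this function modulo \<open>\<pi>\<close>, and
  vanishes where the function is real.
\<close>
definition rotated :: "real \<Rightarrow> complex poly \<Rightarrow> real \<Rightarrow> complex" where
  "rotated \<omega> p x = poly p (\<i> * of_real x) * cis (\<omega> * x / 2)"

lemma rotated_add: "rotated \<omega> (p + q) x = rotated \<omega> p x + rotated \<omega> q x"
  by (simp add: rotated_def algebra_simps)

lemma rotated_minus: "rotated \<omega> (- p) x = - rotated \<omega> p x"
  by (simp add: rotated_def)

lemma rotated_smult: "rotated \<omega> (smult c p) x = c * rotated \<omega> p x"
  by (simp add: rotated_def)

lemma rotated_eq_0_iff: "rotated \<omega> p x = 0 \<longleftrightarrow> poly p (\<i> * of_real x) = 0"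
  by (simp add: rotated_def)

lemma continuous_on_rotated [continuous_intros]: "continuous_on S (rotated \<omega> p)"
  unfolding rotated_def[abs_def] cis_conv_exp by (intro continuous_intros) auto

lemma rotated_mult_cnj:
  "rotated \<omega> p x * cnj (rotated \<omega> q x) = poly (p * dag q) (\<i> * of_real x)"
  by (simp add: rotated_def poly_dag_axis cis_cnj mult_ac cis_mult flip: mult.assoc)

lemma ratfun_eval_unitary:
  assumes "p \<noteq> 0" "poly p (\<i> * of_real x) \<noteq> 0"
  shows "ratfun_eval (Fraction_Field.Fract (dag p) p) (\<i> * of_real x) =
         cnj (poly p (\<i> * of_real x)) / poly p (\<i> * of_real x)"
proof -
  let ?r = "Fraction_Field.Fract (dag p) p"
  let ?a = "fst (quot_of_fract ?r)" and ?b = "snd (quot_of_fract ?r)"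
  have "?r \<in> unitary_ratfuns (degree p)" using assms(1) by (auto simp: unitary_ratfuns_def)
  then have b: "poly ?b (\<i> * of_real x) \<noteq> 0" by (rule unitary_ratfuns_imag_axis(1))
  have "?a * p = dag p * ?b"
    using Fract_quot_of_fract[of ?r] by (simp only: eq_fract(1)[OF snd_quot_of_fract_neq_0 assms(1)])
  then have "poly (?a * p) (\<i> * of_real x) = poly (dag p * ?b) (\<i> * of_real x)" by simp
  with b assms(2) show ?thesis
    by (simp add: ratfun_eval_def poly_dag_axis frac_eq_eq)
qed

text \<open>
  With \<open>P = p(ix)\<close>, \<open>e = exp(i\<omega>x/2)\<close> and \<open>q = P e\<close>, the error \<open>cnj P / P - e\<^sup>2\<close> multiplied by
  \<open>P\<close> is \<open>e (cnj q - q)\<close>.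
\<close>
lemma pointwise_error_rotated:
  assumes "p \<noteq> 0" "poly p (\<i> * of_real x) \<noteq> 0"
  shows "cmod (ratfun_eval (Fraction_Field.Fract (dag p) p) (\<i> * of_real x) - exp (\<i> * of_real (\<omega> * x)))
         * cmod (rotated \<omega> p x) = 2 * \<bar>Im (rotated \<omega> p x)\<bar>"
proof -
  let ?P = "poly p (\<i> * of_real x)" and ?q = "rotated \<omega> p x" and ?e = "cis (\<omega> * x / 2)"
  have e: "exp (\<i> * of_real (\<omega> * x)) = ?e * ?e"
    by (simp add: cis_conv_exp flip: exp_add)
  have "?e * cnj ?q = cnj ?P"
    by (simp add: rotated_def cis_cnj cis_mult mult.left_commute)
  then have "(cnj ?P / ?P - ?e * ?e) * ?P = ?e * (cnj ?q - ?q)"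
    using assms(2) by (simp add: rotated_def algebra_simps)
  then have "cmod (cnj ?P / ?P - ?e * ?e) * cmod ?P = cmod (?e * (cnj ?q - ?q))"
    by (metis norm_mult)
  moreover have "cnj ?q - ?q = - (2 * \<i> * of_real (Im ?q))"
    by (simp add: complex_eq_iff)
  then have "cmod (?e * (cnj ?q - ?q)) = 2 * \<bar>Im ?q\<bar>"
    by (simp add: norm_mult)
  moreover have "cmod ?q = cmod ?P" by (simp add: rotated_def norm_mult)
  ultimately show ?thesis using e ratfun_eval_unitary[OF assms] by simp
qed

lemma approx_error_le_iff:
  assumes "p \<noteq> 0" "\<forall>x\<in>{-1..1}. poly p (\<i> * of_real x) \<noteq> 0"
  shows "approx_error \<omega> (Fraction_Field.Fract (dag p) p) \<le> 2 * s \<longleftrightarrow>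
         (\<forall>x\<in>{-1..1}. \<bar>Im (rotated \<omega> p x)\<bar> \<le> s * cmod (rotated \<omega> p x))" (is ?le)
    and "approx_error \<omega> (Fraction_Field.Fract (dag p) p) < 2 * s \<longleftrightarrow>
         (\<forall>x\<in>{-1..1}. \<bar>Im (rotated \<omega> p x)\<bar> < s * cmod (rotated \<omega> p x))" (is ?less)
proof -
  let ?r = "Fraction_Field.Fract (dag p) p"
  define d where "d x = cmod (ratfun_eval ?r (\<i> * of_real x) - exp (\<i> * of_real (\<omega> * x)))" for x
  have "?r \<in> unitary_ratfuns (degree p)" using assms(1) by (auto simp: unitary_ratfuns_def)
  from approx_error_attained[OF this, of \<omega>]
  obtain x0 where x0: "x0 \<in> {-1..1}" "approx_error \<omega> ?r = d x0" "\<forall>y\<in>{-1..1}. d y \<le> d x0"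
    unfolding d_def by blast
  have d: "d x * cmod (rotated \<omega> p x) = 2 * \<bar>Im (rotated \<omega> p x)\<bar>"
    and pos: "cmod (rotated \<omega> p x) > 0" if "x \<in> {-1..1}" for x
    using that assms pointwise_error_rotated[OF assms(1)] by (auto simp: d_def rotated_eq_0_iff)
  have "d x \<le> 2 * s \<longleftrightarrow> \<bar>Im (rotated \<omega> p x)\<bar> \<le> s * cmod (rotated \<omega> p x)"
    and "d x < 2 * s \<longleftrightarrow> \<bar>Im (rotated \<omega> p x)\<bar> < s * cmod (rotated \<omega> p x)" if "x \<in> {-1..1}" for x
    using mult_le_cancel_right_pos[OF pos[OF that], of "d x" "2 * s"]
      mult_less_cancel_right_pos[OF pos[OF that], of "d x" "2 * s"] d[OF that] by auto
  note d_iff = this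
  have max_iff: "d x0 \<le> 2 * s \<longleftrightarrow> (\<forall>y\<in>{-1..1}. d y \<le> 2 * s)"
    "d x0 < 2 * s \<longleftrightarrow> (\<forall>y\<in>{-1..1}. d y < 2 * s)"
    using x0(1,3) order_trans[of _ "d x0" "2 * s"] le_less_trans[of _ "d x0" "2 * s"] by blast+
  show ?le unfolding x0(2) max_iff by (rule ball_cong[OF refl d_iff(1)])
  show ?less unfolding x0(2) max_iff by (rule ball_cong[OF refl d_iff(2)])
qed

section \<open>The minimal error is less than two\<close>

text \<open>
  Both factors change sign exactly at the interior multiples of \<open>\<pi>\<close>. The induction peels off the first
  period: shifting the argument by \<open>\<pi>\<close> turns the product for \<open>n + 1\<close> into \<open>-t\<close> times the product
  for \<open>n\<close>, and \<open>sin\<close> into \<open>-sin\<close>.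
\<close>
lemma alternating_product_nonneg:
  fixes s :: real
  assumes "0 \<le> s" "s \<le> (real n + 1) * pi"
  shows "(\<Prod>j=1..n. real j * pi - s) * sin s \<ge> 0"
  using assms
proof (induction n arbitrary: s)
  case 0
  then show ?case by (simp add: sin_ge_zero)
next
  case (Suc n)
  show ?case
  proof (cases "s \<le> pi")
    case True
    have "real j * pi - s \<ge> 0" if "j \<in> {1..Suc n}" for j
    proof -
      have "1 * pi \<le> real j * pi" using that by (intro mult_right_mono) auto
      with True show ?thesis by linarith
    qed
    then show ?thesis using Suc.prems True by (intro mult_nonneg_nonneg prod_nonneg sin_ge_zero) auto
  next
    case False
    define t where "t = s - pi"
    have IH: "(\<Prod>j=1..n. real j * pi - t) * sin t \<ge> 0"
      using False Suc.prems by (intro Suc.IH) (auto simp: t_def algebra_simps)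
    have "(\<Prod>j=1..Suc n. real j * pi - s) = (\<Prod>j=0..n. real (Suc j) * pi - s)"
      using prod.shift_bounds_cl_Suc_ivl[of "\<lambda>j. real j * pi - s" 0 n] by simp
    also have "\<dots> = (\<Prod>j=0..n. real j * pi - t)"
      by (simp add: t_def algebra_simps)
    also have "\<dots> = - t * (\<Prod>j=1..n. real j * pi - t)"
      by (simp add: prod.atLeast_Suc_atMost)
    finally have shift: "(\<Prod>j=1..Suc n. real j * pi - s) = - t * (\<Prod>j=1..n. real j * pi - t)" .
    have "sin s = - sin t" by (simp add: t_def sin_diff)
    then have "(\<Prod>j=1..Suc n. real j * pi - s) * sin s = t * ((\<Prod>j=1..n. real j * pi - t) * sin t)"
      unfolding shift by simp
    moreover have "t * ((\<Prod>j=1..n. real j * pi - t) * sin t) \<ge> 0"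
      using IH False by (intro mult_nonneg_nonneg[of t]) (auto simp: t_def)
    ultimately show ?thesis by simp
  qed
qed

text \<open>
  With \<open>t = \<omega>x/2 + (n+1)\<pi>/2\<close> and \<open>p(ix) = cis ((n+1)\<pi>/2) (\<epsilon> Q(t) - i W(t))\<close>, the real part
  of the rotated value is \<open>W(t) sin t + \<epsilon> Q(t) cos t\<close>. For \<open>W(t) = (\<Prod>j=1..n. j\<pi> - t)\<close> the first
  summand is nonnegative with zeros exactly at \<open>t = j\<pi>\<close>, and interpolating \<open>Q = cos\<close> at these \<open>n\<close>
  points makes the second summand positive there.
\<close>
lemma rotated_Re_positive_exists:
  fixes \<omega> :: real
  assumes "0 < \<omega>" "\<omega> < (real n + 1) * pi"
  shows "\<exists>p. degree p \<le> n \<and> (\<forall>x\<in>{-1..1}. Re (rotated \<omega> p x) > 0)"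
proof -
  define \<alpha> where "\<alpha> = (real n + 1) * pi / 2"
  define t where "t x = \<alpha> + \<omega> * x / 2" for x
  define W where "W = (\<Prod>j=1..n. [:real j * pi, -1:])"
  have W: "poly W y = (\<Prod>j=1..n. real j * pi - y)" for y
    by (simp add: W_def poly_prod)
  have degW: "degree W \<le> n"
  proof -
    have "degree W \<le> sum (degree \<circ> (\<lambda>j. [:real j * pi, -1:])) {1..n}"
      unfolding W_def by (rule degree_prod_sum_le) simp
    then show ?thesis by simp
  qed
  obtain Q where Q: "degree Q \<le> card ((\<lambda>j. real j * pi) ` {1..n})"
      "\<forall>y\<in>(\<lambda>j. real j * pi) ` {1..n}. poly Q y = cos y"
    using poly_interpolation_exists[of "(\<lambda>j. real j * pi) ` {1..n}" cos] by auto
  have degQ: "degree Q \<le> n" using Q(1) card_image_le[of "{1..n}" "\<lambda>j. real j * pi"] by simp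
  have t: "0 < t x" "t x < (real n + 1) * pi" if "x \<in> {-1..1}" for x
  proof -
    have "\<bar>\<omega> * x\<bar> \<le> \<omega>" using that assms(1) by (simp add: abs_mult abs_le_iff)
    then show "0 < t x" "t x < (real n + 1) * pi" using assms(2) by (auto simp: t_def \<alpha>_def)
  qed
  have "\<exists>\<epsilon>>0. \<forall>x\<in>{-1..1}. - (poly W (t x) * sin (t x)) + \<epsilon> * - (poly Q (t x) * cos (t x)) + \<epsilon>\<^sup>2 * 0 < 0"
  proof (rule negative_perturbation_on_compact)
    fix x :: real assume x: "x \<in> {-1..1}"
    show "- (poly W (t x) * sin (t x)) \<le> 0"
      using alternating_product_nonneg[of "t x" n] t[OF x] by (simp add: W)
    assume "- (poly W (t x) * sin (t x)) = 0"
    then have "\<exists>j\<in>{1..n}. t x = real j * pi"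
    proof (cases "sin (t x) = 0")
      case True
      then obtain k :: int where k: "t x = of_int k * pi" by (auto simp: sin_zero_iff_int2)
      have "0 < k" "of_int k < real n + 1"
        using t[OF x] unfolding k by (simp_all add: zero_less_mult_iff)
      then have "nat k \<in> {1..n}" "t x = real (nat k) * pi" using k by auto
      then show ?thesis by blast
    qed (force simp: W)
    then obtain j where j: "j \<in> {1..n}" "t x = real j * pi" by blast
    then have "poly Q (t x) * cos (t x) = (cos (real j * pi))\<^sup>2"
      using Q(2) by (simp add: power2_eq_square)
    then show "- (poly Q (t x) * cos (t x)) < 0" by (simp add: cos_npi2)
  qed (auto simp: t_def intro!: continuous_intros)
  then obtain \<epsilon> where "\<forall>x\<in>{-1..1}. - (poly W (t x) * sin (t x)) + \<epsilon> * - (poly Q (t x) * cos (t x)) + \<epsilon>\<^sup>2 * 0 < 0"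
    by blast
  then have \<epsilon>: "\<forall>x\<in>{-1..1}. poly W (t x) * sin (t x) + \<epsilon> * (poly Q (t x) * cos (t x)) > 0"
    by force
  define G where "G = smult (of_real \<epsilon>) (map_poly complex_of_real Q) - smult \<i> (map_poly complex_of_real W)"
  define p where "p = smult (cis \<alpha>) (G \<circ>\<^sub>p [:of_real \<alpha>, - \<i> * of_real (\<omega> / 2):])"
  have map_of_real: "poly (map_poly complex_of_real h) (of_real y) = of_real (poly h y)" for h y
    by (induction h) (simp_all add: map_poly_pCons)
  have degG: "degree G \<le> n"
    unfolding G_def using degW degQ
    by (intro degree_diff_le order_trans[OF degree_smult_le]) (auto simp: degree_map_poly)
  have "degree p \<le> degree G * 1"
    unfolding p_def using degree_pcompose_le[of G "[:of_real \<alpha>, - \<i> * of_real (\<omega> / 2):]"]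
    by (auto intro!: order_trans[OF degree_smult_le] elim!: order_trans)
  then have "degree p \<le> n" using degG by simp
  moreover have "Re (rotated \<omega> p x) = poly W (t x) * sin (t x) + \<epsilon> * (poly Q (t x) * cos (t x))" for x
  proof -
    have arg: "poly [:of_real \<alpha>, - \<i> * of_real (\<omega> / 2):] (\<i> * of_real x) = complex_of_real (t x)"
      by (simp add: t_def complex_eq_iff)
    have "rotated \<omega> p x = poly G (of_real (t x)) * (cis \<alpha> * cis (\<omega> * x / 2))"
      unfolding rotated_def p_def poly_smult poly_pcompose arg by (simp only: mult_ac)
    also have "\<dots> = (of_real (\<epsilon> * poly Q (t x)) - \<i> * of_real (poly W (t x))) * cis (t x)"
      by (simp add: G_def map_of_real) (simp add: cis_mult t_def)
    finally show ?thesis by simp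
  qed
  ultimately show ?thesis using \<epsilon> by auto
qed

section \<open>Extremal points\<close>

text \<open>
  Write \<open>q\<close> and \<open>w\<close> for the rotated values of \<open>p\<close> and of a direction \<open>u\<close>. The condition is
  \<open>(Im q)\<^sup>2 - s\<^sup>2 \<bar>q\<bar>\<^sup>2 \<le> 0\<close>, with equality exactly on \<open>X\<close>. At a point of \<open>X\<close> the derivative of the
  left-hand side in the direction \<open>w\<close> is \<open>2 Re q Im q Im (w cnj q) / \<bar>q\<bar>\<^sup>2\<close>. Neither \<open>Re q\<close> nor
  \<open>Im q\<close> vanishes on \<open>X\<close>, as \<open>0 < s < 1\<close>, so a \<open>u\<close> with \<open>Im (w cnj q) = - Re q Im q\<close> on \<open>X\<close> makes
  the derivative negative.
\<close>
lemma descent_of_few_extremal_points: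
  assumes cop: "coprime p (dag p)" and deg: "degree p \<le> n"
    and s: "0 < s" "s < 1"
    and le: "\<forall>x\<in>{-1..1}. \<bar>Im (rotated \<omega> p x)\<bar> \<le> s * cmod (rotated \<omega> p x)"
    and X: "X = {x \<in> {-1..1}. \<bar>Im (rotated \<omega> p x)\<bar> = s * cmod (rotated \<omega> p x)}"
    and few: "finite X" "card X \<le> n + degree p"
  shows "\<exists>v. degree v \<le> n \<and> (\<forall>x\<in>{-1..1}. \<bar>Im (rotated \<omega> v x)\<bar> < s * cmod (rotated \<omega> v x))"
proof -
  let ?q = "rotated \<omega> p"
  define R where "R x = Re (?q x) * Im (?q x)" for x
  obtain f0 where f0: "degree f0 \<le> card ((\<lambda>x. \<i> * of_real x) ` X)"
      "\<forall>z\<in>(\<lambda>x. \<i> * of_real x) ` X. poly f0 z = - of_real (R (Im z))"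
    using poly_interpolation_exists[of "(\<lambda>x. \<i> * of_real x) ` X" "\<lambda>z. - of_real (R (Im z))"] few(1) by auto
  \<comment> \<open>symmetrising makes the interpolant real on the whole axis without changing its real values on X\<close>
  define f where "f = smult (1/2) (f0 + dag f0)"
  have dag_f: "dag f = f" by (simp add: f_def dag_smult dag_add dag_dag add.commute)
  have "card ((\<lambda>x. \<i> * complex_of_real x) ` X) \<le> card X" by (rule card_image_le[OF few(1)])
  then have "degree f0 \<le> n + degree p" using f0(1) few(2) by simp
  then have deg_f: "degree f \<le> n + degree p"
    unfolding f_def by (simp add: degree_add_le degree_dag)
  have f: "poly f (\<i> * of_real x) = - of_real (R x)" if "x \<in> X" for x
    using f0(2) that by (simp add: f_def poly_dag_axis)
  obtain u where u: "degree u \<le> n" "u * dag p - dag u * p = smult (2 * \<i>) f"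
    using coprime_dag_bezout[OF cop deg dag_f deg_f] by blast
  let ?w = "rotated \<omega> u"
  have cross: "Im (?w x) * Re (?q x) - Re (?w x) * Im (?q x) = - R x" if "x \<in> X" for x
  proof -
    have "?w x * cnj (?q x) - cnj (?w x * cnj (?q x)) = poly (u * dag p - dag u * p) (\<i> * of_real x)"
      unfolding rotated_mult_cnj by (simp add: poly_dag_axis)
    also have "\<dots> = - (2 * \<i> * of_real (R x))" unfolding u(2) using f[OF that] by simp
    finally have "2 * (Im (?w x) * Re (?q x) - Re (?w x) * Im (?q x)) = 2 * - R x"
      by (simp add: complex_eq_iff algebra_simps)
    then show ?thesis by simp
  qed
  define a where "a x = (Im (?q x))\<^sup>2 - s\<^sup>2 * (cmod (?q x))\<^sup>2" for x
  define b where "b x = 2 * (Im (?q x) * Im (?w x) - s\<^sup>2 * (Re (?q x) * Re (?w x) + Im (?q x) * Im (?w x)))" for x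
  define c where "c x = (Im (?w x))\<^sup>2 - s\<^sup>2 * (cmod (?w x))\<^sup>2" for x
  have "\<exists>\<epsilon>>0. \<forall>x\<in>{-1..1}. a x + \<epsilon> * b x + \<epsilon>\<^sup>2 * c x < 0"
  proof (rule negative_perturbation_on_compact)
    fix x :: real assume x: "x \<in> {-1..1}"
    have "\<bar>Im (?q x)\<bar>\<^sup>2 \<le> (s * cmod (?q x))\<^sup>2" using le x by (intro power_mono) auto
    then show "a x \<le> 0" by (simp add: a_def power_mult_distrib)
    assume a0: "a x = 0"
    then have "\<bar>Im (?q x)\<bar>\<^sup>2 = (s * cmod (?q x))\<^sup>2" by (simp add: a_def power_mult_distrib)
    then have "\<bar>Im (?q x)\<bar> = s * cmod (?q x)" using s(1) by (subst (asm) power2_eq_iff_nonneg) auto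
    then have xX: "x \<in> X" using x by (simp add: X)
    define A B C D where defs: "A = Re (?q x)" "B = Im (?q x)" "C = Re (?w x)" "D = Im (?w x)"
    have nz: "?q x \<noteq> 0" using coprime_dag_axis_nonzero[OF cop] by (simp add: rotated_eq_0_iff)
    have N: "A\<^sup>2 + B\<^sup>2 > 0" using nz by (simp add: defs complex_eq_iff sum_power2_gt_zero_iff)
    have B2: "B\<^sup>2 = s\<^sup>2 * (A\<^sup>2 + B\<^sup>2)" using a0 by (simp add: a_def defs cmod_power2)
    have s2: "0 < s\<^sup>2" "s\<^sup>2 < 1" using s by (auto simp: power_less_one_iff abs_square_less_1)
    have "B \<noteq> 0" using B2 N s2 by auto
    moreover have "A \<noteq> 0" using B2 s2 \<open>B \<noteq> 0\<close> by auto
    ultimately have "A\<^sup>2 * B\<^sup>2 > 0" by simp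
    have "(A\<^sup>2 + B\<^sup>2) * b x = 2 * (B * D * (A\<^sup>2 + B\<^sup>2) - (s\<^sup>2 * (A\<^sup>2 + B\<^sup>2)) * (A * C + B * D))"
      by (simp add: b_def defs algebra_simps)
    also have "\<dots> = 2 * (A * B) * (D * A - C * B)"
      unfolding B2[symmetric] by (simp add: algebra_simps power2_eq_square)
    also have "D * A - C * B = - (A * B)"
      using cross[OF xX] by (simp add: defs R_def)
    also have "2 * (A * B) * - (A * B) = - 2 * (A\<^sup>2 * B\<^sup>2)" by (simp add: power2_eq_square)
    finally have "(A\<^sup>2 + B\<^sup>2) * b x < 0" using \<open>A\<^sup>2 * B\<^sup>2 > 0\<close> by simp
    then show "b x < 0" using N by (simp add: mult_less_0_iff)
  qed (auto simp: a_def b_def c_def intro!: continuous_intros)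
  then obtain \<epsilon> where \<epsilon>: "\<forall>x\<in>{-1..1}. a x + \<epsilon> * b x + \<epsilon>\<^sup>2 * c x < 0" by blast
  define v where "v = p + smult (of_real \<epsilon>) u"
  have "\<bar>Im (rotated \<omega> v x)\<bar> < s * cmod (rotated \<omega> v x)" if "x \<in> {-1..1}" for x
  proof -
    have v: "Re (rotated \<omega> v x) = Re (?q x) + \<epsilon> * Re (?w x)"
        "Im (rotated \<omega> v x) = Im (?q x) + \<epsilon> * Im (?w x)"
      by (simp_all add: v_def rotated_add rotated_smult)
    have "(Im (rotated \<omega> v x))\<^sup>2 - s\<^sup>2 * (cmod (rotated \<omega> v x))\<^sup>2 = a x + \<epsilon> * b x + \<epsilon>\<^sup>2 * c x"
      unfolding cmod_power2 v a_def b_def c_def by (simp add: algebra_simps power2_eq_square)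
    then have "\<bar>Im (rotated \<omega> v x)\<bar>\<^sup>2 < (s * cmod (rotated \<omega> v x))\<^sup>2"
      using bspec[OF \<epsilon> that] by (simp add: power_mult_distrib)
    then show ?thesis by (rule power_less_imp_less_base) (use s in simp)
  qed
  moreover have "degree v \<le> n"
    unfolding v_def using deg u(1) by (intro degree_add_le order_trans[OF degree_smult_le]) auto
  ultimately show ?thesis by blast
qed

text \<open>
  At \<open>z = ix\<close> the polynomial \<open>p dag q - dag p q\<close> takes the value \<open>2i Im (p cnj q)\<close>, and its degree is at
  most \<open>n + m\<close>.
\<close>
lemma proportional_of_many_aligned_points:
  assumes "degree p \<le> n" "degree q = m"
    and many: "infinite X \<or> card X > n + m"
    and real: "\<And>x. x \<in> X \<Longrightarrow> Im (rotated \<omega> p x * cnj (rotated \<omega> q x)) = 0"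
  shows "p * dag q = dag p * q"
proof (rule ccontr)
  assume neq: "p * dag q \<noteq> dag p * q"
  define h where "h = p * dag q - dag p * q"
  have h0: "h \<noteq> 0" using neq by (simp add: h_def)
  have "degree h \<le> n + m"
    unfolding h_def using assms(1,2) degree_mult_le[of p "dag q"] degree_mult_le[of "dag p" q]
    by (intro degree_diff_le) (auto simp: degree_dag)
  have inj: "inj_on (\<lambda>x. \<i> * complex_of_real x) X" by (auto simp: inj_on_def)
  have sub: "(\<lambda>x. \<i> * complex_of_real x) ` X \<subseteq> {z. poly h z = 0}"
  proof clarify
    fix x assume "x \<in> X"
    have "poly h (\<i> * of_real x) = rotated \<omega> p x * cnj (rotated \<omega> q x) - cnj (rotated \<omega> p x * cnj (rotated \<omega> q x))"
      unfolding rotated_mult_cnj h_def by (simp add: poly_dag_axis)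
    then show "poly h (\<i> * of_real x) = 0" using real[OF \<open>x \<in> X\<close>] by (simp add: complex_eq_iff)
  qed
  have fin: "finite {z. poly h z = 0}" by (rule poly_roots_finite[OF h0])
  have "finite X" using finite_subset[OF sub fin] inj by (simp add: finite_image_iff)
  moreover have "card X \<le> n + m"
    using card_mono[OF fin sub] card_poly_roots_bound[OF h0] \<open>degree h \<le> n + m\<close>
    by (simp add: card_image[OF inj])
  ultimately show False using many by simp
qed

section \<open>Uniqueness of the best approximation\<close>

text \<open>
  The left-hand condition describes a double sector; on its right half it becomes the linear, and hence
  convex, condition on the right.
\<close>
lemma sector_iff_cone:
  assumes "0 \<le> s" "s < 1" "Re q > 0"
  defines "\<tau> \<equiv> s / sqrt (1 - s\<^sup>2)"
  shows "\<bar>Im q\<bar> \<le> s * cmod q \<longleftrightarrow> \<bar>Im q\<bar> \<le> \<tau> * Re q"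
    and "\<bar>Im q\<bar> = s * cmod q \<longleftrightarrow> \<bar>Im q\<bar> = \<tau> * Re q"
proof -
  have s2: "1 - s\<^sup>2 > 0" using assms by (simp add: abs_square_less_1)
  have nn: "0 \<le> s * cmod q" "0 \<le> \<tau> * Re q" using assms s2 by (auto simp: \<tau>_def)
  have sq: "(s * cmod q)\<^sup>2 = s\<^sup>2 * ((Re q)\<^sup>2 + (Im q)\<^sup>2)" "(\<tau> * Re q)\<^sup>2 = s\<^sup>2 * (Re q)\<^sup>2 / (1 - s\<^sup>2)"
    using s2 by (auto simp: \<tau>_def power_mult_distrib power_divide cmod_power2)
  have "\<bar>Im q\<bar> \<le> s * cmod q \<longleftrightarrow> (Im q)\<^sup>2 \<le> (s * cmod q)\<^sup>2"
    using nn abs_le_square_iff[of "Im q" "s * cmod q"] by simp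
  also have "\<dots> \<longleftrightarrow> (Im q)\<^sup>2 \<le> (\<tau> * Re q)\<^sup>2"
    unfolding sq using s2 by (simp add: field_simps)
  also have "\<dots> \<longleftrightarrow> \<bar>Im q\<bar> \<le> \<tau> * Re q"
    using nn abs_le_square_iff[of "Im q" "\<tau> * Re q"] by simp
  finally show "\<bar>Im q\<bar> \<le> s * cmod q \<longleftrightarrow> \<bar>Im q\<bar> \<le> \<tau> * Re q" .
  have "\<bar>Im q\<bar> = s * cmod q \<longleftrightarrow> (Im q)\<^sup>2 = (s * cmod q)\<^sup>2"
    using nn power2_eq_iff_nonneg[of "\<bar>Im q\<bar>" "s * cmod q"] by simp
  also have "\<dots> \<longleftrightarrow> (Im q)\<^sup>2 = (\<tau> * Re q)\<^sup>2"
    unfolding sq using s2 by (simp add: field_simps)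
  also have "\<dots> \<longleftrightarrow> \<bar>Im q\<bar> = \<tau> * Re q"
    using nn power2_eq_iff_nonneg[of "\<bar>Im q\<bar>" "\<tau> * Re q"] by simp
  finally show "\<bar>Im q\<bar> = s * cmod q \<longleftrightarrow> \<bar>Im q\<bar> = \<tau> * Re q" .
qed

text \<open>
  For \<open>s < 1\<close> the double sector meets the imaginary axis only at \<open>0\<close>, which the rotated values of a reduced
  \<open>p\<close> avoid. By connectedness they stay in one half of the sector, and replacing \<open>p\<close> by \<open>-p\<close> does not
  change the rational function.
\<close>
lemma right_half_plane_representative:
  assumes r: "r \<in> unitary_ratfuns n" and err: "approx_error \<omega> r \<le> 2 * s" and s: "0 \<le> s" "s < 1"
  obtains p where "p \<noteq> 0" "degree p \<le> n" "r = Fraction_Field.Fract (dag p) p"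
    "\<And>x. x \<in> {-1..1} \<Longrightarrow> Re (rotated \<omega> p x) > 0"
    "\<And>x. x \<in> {-1..1} \<Longrightarrow> \<bar>Im (rotated \<omega> p x)\<bar> \<le> s * cmod (rotated \<omega> p x)"
proof -
  obtain p where p: "coprime p (dag p)" "p \<noteq> 0" "degree p \<le> n" "r = Fraction_Field.Fract (dag p) p"
    using unitary_ratfuns_reduced[OF r] by blast
  have le: "\<bar>Im (rotated \<omega> p x)\<bar> \<le> s * cmod (rotated \<omega> p x)" if "x \<in> {-1..1}" for x
    using approx_error_le_iff(1)[of p \<omega> s] p err coprime_dag_axis_nonzero[OF p(1)] that by auto
  have nz: "Re (rotated \<omega> p x) \<noteq> 0" if "x \<in> {-1..1}" for x
  proof
    assume "Re (rotated \<omega> p x) = 0"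
    then have "cmod (rotated \<omega> p x) = \<bar>Im (rotated \<omega> p x)\<bar>" by (simp add: cmod_eq_Im)
    moreover have "rotated \<omega> p x \<noteq> 0" using coprime_dag_axis_nonzero[OF p(1)] by (simp add: rotated_eq_0_iff)
    then have "s * cmod (rotated \<omega> p x) < cmod (rotated \<omega> p x)" using s by simp
    ultimately show False using le[OF that] by simp
  qed
  have cont: "continuous_on {-1..1} (\<lambda>x. Re (rotated \<omega> p x))" by (intro continuous_intros)
  have conn: "connected ((\<lambda>x. Re (rotated \<omega> p x)) ` {-1..1})"
    by (intro connected_continuous_image cont) simp
  have "(\<forall>x\<in>{-1..1}. Re (rotated \<omega> p x) > 0) \<or> (\<forall>x\<in>{-1..1}. Re (rotated \<omega> p x) < 0)"
  proof (rule ccontr)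
    assume "\<not> ?thesis"
    then obtain x y where "x \<in> {-1..1}" "y \<in> {-1..1}" "Re (rotated \<omega> p x) \<le> 0" "0 \<le> Re (rotated \<omega> p y)"
      by (meson not_le)
    then have "0 \<in> (\<lambda>x. Re (rotated \<omega> p x)) ` {-1..1}"
      using connectedD_interval[OF conn] by blast
    with nz show False by auto
  qed
  then show ?thesis
  proof
    assume "\<forall>x\<in>{-1..1}. Re (rotated \<omega> p x) > 0"
    with that[of p] p le show ?thesis by blast
  next
    assume neg: "\<forall>x\<in>{-1..1}. Re (rotated \<omega> p x) < 0"
    show ?thesis
    proof (rule that[of "- p"])
      show "- p \<noteq> 0" "degree (- p) \<le> n" "r = Fraction_Field.Fract (dag (- p)) (- p)"
        using p(2-4) by (simp_all add: dag_minus)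
      fix x :: real assume x: "x \<in> {-1..1}"
      show "Re (rotated \<omega> (- p) x) > 0" using bspec[OF neg x] by (simp add: rotated_minus)
      show "\<bar>Im (rotated \<omega> (- p) x)\<bar> \<le> s * cmod (rotated \<omega> (- p) x)"
        using le[OF x] by (simp add: rotated_minus)
    qed
  qed
qed

text \<open>
  The argument runs through the reduced form \<open>p'\<close> of the sum \<open>p1 + p2\<close>, because its degree decides both
  how many values can be prescribed for a descent and how many zeros \<open>p1 dag p' - dag p1 p'\<close> can
  have. If the minimal error is \<open>0\<close>, there is no descent, but then every point of \<open>[-1,1]\<close> is
  extremal.
\<close>
theorem best_approx_unique:
  assumes \<omega>: "0 < \<omega>" "\<omega> < (real n + 1) * pi"
    and r1: "is_best_approx n \<omega> r1" and r2: "is_best_approx n \<omega> r2"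
  shows "r1 = r2"
proof -
  define s where "s = approx_error \<omega> r1 / 2"
  have U: "r1 \<in> unitary_ratfuns n" "r2 \<in> unitary_ratfuns n"
    using r1 r2 by (auto simp: is_best_approx_def)
  have err: "approx_error \<omega> r1 \<le> 2 * s" "approx_error \<omega> r2 \<le> 2 * s"
    using r1 r2 by (auto simp: is_best_approx_def s_def)
  have s0: "s \<ge> 0"
    using approx_error_attained[OF U(1), of \<omega>] by (auto simp: s_def)
  \<comment> \<open>applied with \<open>t = 1\<close> to see that \<open>s < 1\<close>, and with \<open>t = s\<close> to exclude a descent\<close>
  have not_below: False
    if v: "degree v \<le> n" and less: "\<forall>x\<in>{-1..1}. \<bar>Im (rotated \<omega> v x)\<bar> < t * cmod (rotated \<omega> v x)" and "t \<le> s" for v t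
  proof -
    have nz: "\<forall>x\<in>{-1..1}. poly v (\<i> * of_real x) \<noteq> 0"
    proof
      fix x :: real assume "x \<in> {-1..1}"
      then have "rotated \<omega> v x \<noteq> 0" using bspec[OF less, of x] by auto
      then show "poly v (\<i> * of_real x) \<noteq> 0" by (simp add: rotated_eq_0_iff)
    qed
    have "v \<noteq> 0" using bspec[OF nz, of 0] by auto
    then have "approx_error \<omega> (Fraction_Field.Fract (dag v) v) < 2 * t" "Fraction_Field.Fract (dag v) v \<in> unitary_ratfuns n"
      using approx_error_le_iff(2)[of v \<omega> t] nz less v by (auto simp: unitary_ratfuns_def)
    with r1 \<open>t \<le> s\<close> show False by (force simp: is_best_approx_def s_def)
  qed
  have s1: "s < 1"
  proof (rule ccontr)
    assume "\<not> s < 1"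
    obtain p where p: "degree p \<le> n" "\<forall>x\<in>{-1..1}. Re (rotated \<omega> p x) > 0"
      using rotated_Re_positive_exists[OF \<omega>] by blast
    have "\<bar>Im z\<bar> < 1 * cmod z" if "Re z > 0" for z
    proof -
      have "\<bar>Im z\<bar>\<^sup>2 < (cmod z)\<^sup>2" using that by (simp add: cmod_power2)
      then show ?thesis using power_less_imp_less_base[of "\<bar>Im z\<bar>" 2 "cmod z"] by simp
    qed
    then show False using not_below[of p 1] p \<open>\<not> s < 1\<close> by auto
  qed
  define \<tau> where "\<tau> = s / sqrt (1 - s\<^sup>2)"
  obtain p1 where p1: "p1 \<noteq> 0" "degree p1 \<le> n" "r1 = Fraction_Field.Fract (dag p1) p1"
      "\<And>x. x \<in> {-1..1} \<Longrightarrow> Re (rotated \<omega> p1 x) > 0"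
      "\<And>x. x \<in> {-1..1} \<Longrightarrow> \<bar>Im (rotated \<omega> p1 x)\<bar> \<le> s * cmod (rotated \<omega> p1 x)"
    using right_half_plane_representative[OF U(1) err(1) s0 s1] by blast
  obtain p2 where p2: "p2 \<noteq> 0" "degree p2 \<le> n" "r2 = Fraction_Field.Fract (dag p2) p2"
      "\<And>x. x \<in> {-1..1} \<Longrightarrow> Re (rotated \<omega> p2 x) > 0"
      "\<And>x. x \<in> {-1..1} \<Longrightarrow> \<bar>Im (rotated \<omega> p2 x)\<bar> \<le> s * cmod (rotated \<omega> p2 x)"
    using right_half_plane_representative[OF U(2) err(2) s0 s1] by blast
  define p where "p = p1 + p2"
  have q: "rotated \<omega> p x = rotated \<omega> p1 x + rotated \<omega> p2 x" for x
    by (simp add: p_def rotated_add)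
  have Re_pos: "Re (rotated \<omega> p x) > 0" if "x \<in> {-1..1}" for x
    using p1(4)[OF that] p2(4)[OF that] by (simp add: q)
  have cone: "\<bar>Im (rotated \<omega> p1 x)\<bar> \<le> \<tau> * Re (rotated \<omega> p1 x)"
      "\<bar>Im (rotated \<omega> p2 x)\<bar> \<le> \<tau> * Re (rotated \<omega> p2 x)" if "x \<in> {-1..1}" for x
    using sector_iff_cone(1)[OF s0 s1] p1(4,5) p2(4,5) that unfolding \<tau>_def by blast+
  have p_le: "\<bar>Im (rotated \<omega> p x)\<bar> \<le> s * cmod (rotated \<omega> p x)" if "x \<in> {-1..1}" for x
  proof -
    have "\<bar>Im (rotated \<omega> p x)\<bar> \<le> \<tau> * Re (rotated \<omega> p x)"
      using cone[OF that] by (simp add: q distrib_left)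
    then show ?thesis using sector_iff_cone(1)[OF s0 s1 Re_pos[OF that]] by (simp add: \<tau>_def)
  qed
  have p0: "p \<noteq> 0" using Re_pos[of 0] by (auto simp: rotated_def)
  obtain g p' where g: "p = g * p'" "dag g = g" "coprime p' (dag p')"
    using dag_reduced_factorization[OF p0] by blast
  have nz: "g \<noteq> 0" "p' \<noteq> 0" using p0 g(1) by auto
  have "degree p \<le> n" unfolding p_def by (rule degree_add_le[OF p1(2) p2(2)])
  then have deg': "degree p' \<le> n" using nz by (simp add: g(1) degree_mult_eq)
  define \<gamma> where "\<gamma> x = Re (poly g (\<i> * of_real x))" for x
  have "poly g (\<i> * of_real x) = of_real (\<gamma> x)" for x
    using poly_dag_axis[of g x] by (simp add: g(2) \<gamma>_def complex_eq_iff)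
  then have rot': "rotated \<omega> p x = of_real (\<gamma> x) * rotated \<omega> p' x" for x
    by (simp add: g(1) rotated_def)
  have \<gamma>_nz: "\<gamma> x \<noteq> 0" if "x \<in> {-1..1}" for x using Re_pos[OF that] by (auto simp: rot')
  have le': "\<bar>Im (rotated \<omega> p' x)\<bar> \<le> s * cmod (rotated \<omega> p' x)" if "x \<in> {-1..1}" for x
    using p_le[OF that] \<gamma>_nz[OF that] by (simp add: rot' norm_mult abs_mult mult.left_commute[of s])
  define X where "X = {x \<in> {-1..1}. \<bar>Im (rotated \<omega> p' x)\<bar> = s * cmod (rotated \<omega> p' x)}"
  have many: "infinite X \<or> card X > n + degree p'"
  proof (rule ccontr)
    assume "\<not> ?thesis"
    then have few: "finite X" "card X \<le> n + degree p'" by auto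
    have "s \<noteq> 0"
    proof
      assume "s = 0"
      then have "X = {-1..1}" using le' by (force simp: X_def)
      with few(1) show False by (simp add: infinite_Icc)
    qed
    then obtain v where "degree v \<le> n" "\<forall>x\<in>{-1..1}. \<bar>Im (rotated \<omega> v x)\<bar> < s * cmod (rotated \<omega> v x)"
      using descent_of_few_extremal_points[OF g(3) deg' _ s1 _ X_def few] le' s0 by auto
    then show False using not_below[of v s] by simp
  qed
  \<comment> \<open>equality for the sum forces equality, with the same sign, for each of the two summands\<close>
  have aligned: "Im (rotated \<omega> p1 x * cnj (rotated \<omega> p' x)) = 0" if "x \<in> X" for x
  proof -
    have x: "x \<in> {-1..1}" using that by (simp add: X_def)
    have "\<bar>Im (rotated \<omega> p x)\<bar> = s * cmod (rotated \<omega> p x)"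
      using that by (simp add: X_def rot' norm_mult abs_mult)
    then have "\<bar>Im (rotated \<omega> p x)\<bar> = \<tau> * Re (rotated \<omega> p x)"
      using sector_iff_cone(2)[OF s0 s1 Re_pos[OF x]] by (simp add: \<tau>_def)
    then have "Im (rotated \<omega> p1 x) = \<tau> * Re (rotated \<omega> p1 x) \<and> Im (rotated \<omega> p x) = \<tau> * Re (rotated \<omega> p x) \<or>
          Im (rotated \<omega> p1 x) = - (\<tau> * Re (rotated \<omega> p1 x)) \<and> Im (rotated \<omega> p x) = - (\<tau> * Re (rotated \<omega> p x))"
      using cone[OF x] by (simp add: q distrib_left) linarith
    then have "Im (rotated \<omega> p1 x * cnj (rotated \<omega> p x)) = 0"
      by (auto simp: algebra_simps)
    then have "\<gamma> x * Im (rotated \<omega> p1 x * cnj (rotated \<omega> p' x)) = 0"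
      by (simp add: rot' algebra_simps)
    then show ?thesis using \<gamma>_nz[OF x] by simp
  qed
  have "p1 * dag p' = dag p1 * p'"
    using proportional_of_many_aligned_points[OF p1(2) refl many aligned] .
  then have "p1 * dag p = dag p1 * p"
    by (simp add: g(1,2) dag_mult mult.left_commute)
  then have "dag p1 * p2 = dag p2 * p1"
    by (simp add: p_def dag_add algebra_simps)
  then show ?thesis using p1(1) p2(1) by (simp add: p1(3) p2(3) eq_fract)
qed

section \<open>Symmetry\<close>

text \<open>
  For \<open>r = dag p / p\<close> the function \<open>1 / r(-z)\<close> is \<open>dag c / c\<close>, where \<open>c(z) = dag p (-z)\<close> is \<open>p\<close> with
  conjugated coefficients. The rotated value of \<open>c\<close> at \<open>x\<close> is the conjugate of the rotated value of
  \<open>p\<close> at \<open>-x\<close>, so the errors agree after reflection of \<open>[-1,1]\<close>.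
\<close>
lemma reflected_inverse_unitary:
  assumes "r \<in> unitary_ratfuns n"
  shows "inverse (ratfun_reflect r) \<in> unitary_ratfuns n"
    and "approx_error \<omega> (inverse (ratfun_reflect r)) = approx_error \<omega> r"
proof -
  obtain p where p: "coprime p (dag p)" "p \<noteq> 0" "degree p \<le> n" "r = Fraction_Field.Fract (dag p) p"
    using unitary_ratfuns_reduced[OF assms] by blast
  define pc where "pc = dag p \<circ>\<^sub>p [:0, -1:]"
  have dag_pc: "dag pc = p \<circ>\<^sub>p [:0, -1:]"
    by (rule poly_ext) (simp add: pc_def poly_dag poly_pcompose)
  have inv: "inverse (ratfun_reflect r) = Fraction_Field.Fract (dag pc) pc"
    unfolding dag_pc using p(2) by (simp add: p(4) ratfun_reflect_Fract pc_def)
  have pc0: "pc \<noteq> 0" using p(2) by (simp add: pc_def pcompose_uminus_eq_0_iff dag_eq_0_iff)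
  have deg: "degree pc \<le> n" using p(3) by (simp add: pc_def degree_pcompose degree_dag)
  show "inverse (ratfun_reflect r) \<in> unitary_ratfuns n"
    unfolding inv unitary_ratfuns_def using pc0 deg by blast
  have rot: "rotated \<omega> pc x = cnj (rotated \<omega> p (- x))" for x
    by (simp add: rotated_def pc_def poly_pcompose poly_dag cis_cnj)
  have nz: "poly p (\<i> * of_real x) \<noteq> 0" for x by (rule coprime_dag_axis_nonzero[OF p(1)])
  have nz': "poly pc (\<i> * of_real x) \<noteq> 0" for x
  proof -
    have "rotated \<omega> p (- x) \<noteq> 0" using nz[of "- x"] by (subst rotated_eq_0_iff)
    then have "rotated \<omega> pc x \<noteq> 0" unfolding rot by simp
    then show ?thesis by (simp only: rotated_eq_0_iff not_False_eq_True)
  qed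
  have same_bounds:
    "approx_error \<omega> (Fraction_Field.Fract (dag pc) pc) \<le> 2 * s \<longleftrightarrow> approx_error \<omega> r \<le> 2 * s" for s
  proof -
    define P where "P x \<longleftrightarrow> \<bar>Im (rotated \<omega> p x)\<bar> \<le> s * cmod (rotated \<omega> p x)" for x
    have "approx_error \<omega> (Fraction_Field.Fract (dag pc) pc) \<le> 2 * s \<longleftrightarrow> (\<forall>x\<in>{-1..1}. P (- x))"
      using approx_error_le_iff(1)[of pc \<omega> s] pc0 nz' by (simp add: rot P_def)
    also have "\<dots> \<longleftrightarrow> (\<forall>x\<in>uminus ` {-1..1}. P x)" by (simp only: ball_simps)
    also have "\<dots> \<longleftrightarrow> approx_error \<omega> r \<le> 2 * s"
      using approx_error_le_iff(1)[of p \<omega> s] p(2) nz by (simp add: p(4) P_def)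
    finally show ?thesis .
  qed
  have "approx_error \<omega> (Fraction_Field.Fract (dag pc) pc) \<le> approx_error \<omega> r"
    using same_bounds[of "approx_error \<omega> r / 2"] by simp
  moreover have "approx_error \<omega> r \<le> approx_error \<omega> (Fraction_Field.Fract (dag pc) pc)"
    using same_bounds[of "approx_error \<omega> (Fraction_Field.Fract (dag pc) pc) / 2"] by simp
  ultimately show "approx_error \<omega> (inverse (ratfun_reflect r)) = approx_error \<omega> r"
    unfolding inv by (rule antisym)
qed

theorem proposition6p2:
  fixes n :: nat and \<omega> :: real and r :: ratfun
  assumes "n \<ge> 1"
    and "0 < \<omega>" and "\<omega> < (real n + 1) * pi"
    and "is_best_approx n \<omega> r"
  shows "ratfun_reflect r = inverse r"
proof -
  have "is_best_approx n \<omega> (inverse (ratfun_reflect r))"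
    using assms(4) reflected_inverse_unitary[of r n] by (simp add: is_best_approx_def)
  then have "inverse (ratfun_reflect r) = r"
    using best_approx_unique[OF assms(2,3)] assms(4) by blast
  then show ?thesis by (metis inverse_inverse_eq)
qed

end
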